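(* Let $\alpha>0$, let $n\ge2$ be an integer, let $X_1,\dots,X_n$ be i.i.d. random variables with gamma density $\Gamma(\alpha)^{-1}x^{\alpha-1}e^{-x}$, $x>0$, and let $U=\left(\sum_{i=1}^nX_i^2\right)^{1/2}\big/\sum_{i=1}^nX_i$. Let $F_{U^2}$ be the cumulative distribution function of $U^2$ and $\mu_{2k}=E\left(U^{2k}\right)$. If the probability density of $U$ is square integrable (equivalently, the density of $U^2$ is square integrable), then for $n^{-1}\le x\le1$ $$1-F_{U^2}(x)=\sum_{k=0}^\infty(-1)^k(2k+1)\left(\sum_{j=0}^k(-1)^j\frac{(k-j+1)_{2j}}{j!\,j!}\,\frac{\mu_{2(j+1)}}{j+1}\right)P_k^\ast(x),$$ where the series converges.
   Context: Pochhammer symbol: $(c)_k=\prod_{i=0}^{k-1}(c+i)$, $(c)_0=1$. $P_k^\ast(x)=P_k(2x-1)$ is the shifted Legendre polynomial, where $P_k$ is the Legendre polynomial. The random variable $U^2$ takes values in $[n^{-1},1]$. *)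

theory Defs
  imports "HOL-Probability.Probability" "HOL-Computational_Algebra.Polynomial"
begin

definition gamma_density :: "real \<Rightarrow> real \<Rightarrow> real" where
  "gamma_density \<alpha> x =
     (if 0 < x then x powr (\<alpha> - 1) * exp (- x) / Gamma \<alpha> else 0)"

(* Rodrigues' formula *)
definition legendre :: "nat \<Rightarrow> real poly" where
  "legendre k = smult (1 / (2 ^ k * fact k)) ((pderiv ^^ k) ([:-1, 0, 1:] ^ k))"

definition shifted_legendre :: "nat \<Rightarrow> real \<Rightarrow> real" where
  "shifted_legendre k x = poly (legendre k) (2 * x - 1)"

(* On the null set where the denominator vanishes, the value is 0. *)
definition self_norm_ratio :: "nat \<Rightarrow> (nat \<Rightarrow> 'a \<Rightarrow> real) \<Rightarrow> 'a \<Rightarrow> real" where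
  "self_norm_ratio n X \<omega> = sqrt (\<Sum>i = 1..n. (X i \<omega>)\<^sup>2) / (\<Sum>i = 1..n. X i \<omega>)"

(* Densities are unique up to null sets, so the choice of f is immaterial. *)
definition has_square_integrable_density :: "'a measure \<Rightarrow> ('a \<Rightarrow> real) \<Rightarrow> bool" where
  "has_square_integrable_density M Y \<longleftrightarrow>
     (\<exists>f :: real \<Rightarrow> real. (\<forall>x. 0 \<le> f x) \<and>
        distributed M lborel Y (\<lambda>x. ennreal (f x)) \<and>
        integrable lborel (\<lambda>x. (f x)\<^sup>2))"

end

theory Submission
  imports Defs
begin

text \<open>
  Put \<open>V = U\<^sup>2\<close>. The variables \<open>X i\<close> are almost surely positive, so \<open>V\<close> lies in \<open>[1 / n, 1]\<close>
  and \<open>1 - F x\<close> is the tail probability \<open>P (V > x)\<close>. The identity holds for every random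
  variable \<open>V\<close> in \<open>[0, 1]\<close> with a square integrable density \<open>f\<close>, and this is how it is proved.

  Write \<open>P\<^sub>k\<close> for the shifted Legendre polynomials, \<open>b\<^sub>k = E (P\<^sub>k V)\<close>, and let \<open>d\<^sub>k\<close> be the integral
  of \<open>P\<^sub>k\<close> over \<open>[x, 1]\<close>. Estimating the terms of the series one by one does not give convergence when
  \<open>f\<close> is merely square integrable. The remedy is to exchange the roles of \<open>x\<close> and \<open>V\<close>. The inner sum over \<open>j\<close>, with its sign, is the expectation at \<open>V\<close> of the primitive of \<open>P\<^sub>k\<close>
  that vanishes at 0. As \<open>P\<^sub>k\<^sub>+\<^sub>1' - P\<^sub>k\<^sub>-\<^sub>1' = 2 (2 k + 1) P\<^sub>k\<close>, the \<open>k\<close>-th term, for \<open>k \<ge> 1\<close>, is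
  \<open>(b\<^sub>k\<^sub>+\<^sub>1 - b\<^sub>k\<^sub>-\<^sub>1) P\<^sub>k x / 2\<close>, whereas \<open>(2 k + 1) d\<^sub>k = (P\<^sub>k\<^sub>-\<^sub>1 x - P\<^sub>k\<^sub>+\<^sub>1 x) / 2\<close>. Summation by parts
  (\<open>slegendre_series_by_parts\<close>) therefore turns the \<open>N\<close>-th partial sum into the sum of
  \<open>(2 k + 1) b\<^sub>k d\<^sub>k\<close> over \<open>k \<le> N\<close> plus the boundary term
  \<open>(b\<^sub>N\<^sub>+\<^sub>1 P\<^sub>N x + b\<^sub>N P\<^sub>N\<^sub>+\<^sub>1 x) / 2\<close>.

  The new sum is \<open>E (p\<^sub>N V)\<close>, where \<open>p\<^sub>N\<close> is the least-squares approximation, among polynomials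
  of degree at most \<open>N\<close>, of the step function that is 1 on \<open>(x, 1]\<close> and 0 elsewhere.
  By the Weierstrass theorem \<open>p\<^sub>N\<close> converges to the step in mean square
  (\<open>step_proj_tendsto\<close>), and since \<open>f\<close> is square integrable an expectation \<open>E (g V)\<close> is controlled by
  the mean square of \<open>g\<close> (\<open>expectation_L2_bound\<close>); hence \<open>E (p\<^sub>N V)\<close> tends to \<open>P (V > x)\<close>. The same
  control and the squared norm \<open>1 / (2 k + 1)\<close> of \<open>P\<^sub>k\<close> give that \<open>b\<^sub>k\<close> tends to 0, and
  \<open>\<bar>P\<^sub>k x\<bar> \<le> 1\<close> makes the boundary term vanish.

  Square integrability passes between \<open>U\<close> and \<open>U\<^sup>2\<close> because \<open>U\<close> stays away from 0, so that squaring
  and the square root both have bounded derivatives on the relevant intervals.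
\<close>

section \<open>Shifted Legendre polynomials by their coefficients\<close>

text \<open>The ascending powers of the polynomial given by Rodrigues' formula after the substitution
  \<open>2 x - 1\<close>. The binomials are written with \<open>pochhammer\<close>, so that the coefficient is a polynomial
  in \<open>k\<close> and vanishes by itself for \<open>j > k\<close>.\<close>

definition slegendre :: "nat \<Rightarrow> real poly" where
  "slegendre k = (\<Sum>j\<le>k. monom ((-1) ^ (k + j) * pochhammer (real k - real j + 1) (2 * j) / (fact j)\<^sup>2) j)"

lemma coeff_slegendre:
  "coeff (slegendre k) j = (-1) ^ (k + j) * pochhammer (real k - real j + 1) (2 * j) / (fact j)\<^sup>2"
proof (cases "j \<le> k")
  case True
  then show ?thesis by (simp add: slegendre_def coeff_sum)
next
  case False
  have "pochhammer (real k - real j + 1) (2 * j) = 0"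
    unfolding pochhammer_eq_0_iff
    by (rule exI[of _ "j - k - 1"]) (use False in \<open>auto simp: of_nat_diff\<close>)
  with False show ?thesis by (simp add: slegendre_def coeff_sum)
qed

lemma pochhammer_extend_both:
  fixes a :: "'a :: comm_semiring_1"
  shows "pochhammer a (Suc (Suc m)) = a * (a + of_nat m + 1) * pochhammer (a + 1) m"
  unfolding pochhammer_rec[of a] pochhammer_Suc[of "a + 1"] by (simp add: algebra_simps)

text \<open>The two-term recurrence in \<open>j\<close> that encodes Legendre's differential equation.\<close>

lemma coeff_slegendre_Suc:
  "(real j + 1)\<^sup>2 * coeff (slegendre k) (Suc j) = (real j * (real j + 1) - real k * (real k + 1)) * coeff (slegendre k) j"
proof -
  define c where "c = pochhammer (real k - real j + 1) (2 * j)"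
  define e :: real where "e = (-1) ^ (k + j)"
  define d where "d = real j + 1"
  have d: "d \<noteq> 0" by (simp add: d_def)
  have "pochhammer (real k - real (Suc j) + 1) (2 * Suc j) =
      (real k - real j) * (real k + real j + 1) * c"
    using pochhammer_extend_both[of "real k - real j" "2 * j"] by (simp add: c_def)
  then have 1: "coeff (slegendre k) (Suc j) = - e * ((real k - real j) * (real k + real j + 1) * c) / (d * fact j)\<^sup>2"
    unfolding coeff_slegendre by (simp add: e_def d_def add_ac)
  have 2: "coeff (slegendre k) j = e * c / (fact j)\<^sup>2"
    by (simp add: coeff_slegendre e_def c_def)
  have "d\<^sup>2 * coeff (slegendre k) (Suc j) = (real j * (real j + 1) - real k * (real k + 1)) * coeff (slegendre k) j"
    unfolding 1 2 using d by (simp add: power_mult_distrib) (simp add: divide_simps, simp add: algebra_simps)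
  then show ?thesis by (simp add: d_def)
qed

text \<open>The Pochhammer products of the two outer polynomials contain the middle one as a common factor;
  what is left is the difference of \<open>(k + j + 2) (k + j + 3)\<close> and \<open>(k - j) (k - j + 1)\<close>.
  This identity is what makes summation by parts possible.\<close>

lemma pderiv_slegendre:
  "pderiv (slegendre (Suc (Suc k))) - pderiv (slegendre k) = smult (2 * (2 * real k + 3)) (slegendre (Suc k))"
proof (rule poly_eqI)
  fix j
  define c where "c = pochhammer (real k - real j + 2) (2 * j)"
  define e :: real where "e = (-1) ^ (k + j)"
  define d where "d = real j + 1"
  have d: "d \<noteq> 0" by (simp add: d_def)
  have j: "real j = d - 1" by (simp add: d_def)
  have "pochhammer (real (Suc (Suc k)) - real (Suc j) + 1) (2 * Suc j)
      = c * ((real k + real j + 2) * (real k + real j + 3))"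
    by (simp add: c_def pochhammer_Suc algebra_simps)
  then have 1: "coeff (slegendre (Suc (Suc k))) (Suc j) = - e * (c * ((real k + d + 1) * (real k + d + 2))) / (d * fact j)\<^sup>2"
    unfolding coeff_slegendre by (simp add: e_def d_def add_ac)
  have "pochhammer (real k - real (Suc j) + 1) (2 * Suc j)
      = ((real k - real j) * (real k - real j + 1)) * c"
    by (simp add: c_def pochhammer_rec algebra_simps)
  then have 2: "coeff (slegendre k) (Suc j) = - e * (((real k - (d - 1)) * (real k - (d - 1) + 1)) * c) / (d * fact j)\<^sup>2"
    unfolding coeff_slegendre by (simp add: e_def d_def add_ac)
  have 3: "coeff (slegendre (Suc k)) j = - e * c / (fact j)\<^sup>2"
    unfolding coeff_slegendre c_def e_def by (simp add: algebra_simps)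
  have "d * (coeff (slegendre (Suc (Suc k))) (Suc j)) - d * coeff (slegendre k) (Suc j)
     = (2 * (2 * real k + 3)) * coeff (slegendre (Suc k)) j"
    unfolding 1 2 3 using d by (simp add: power_mult_distrib) (simp add: divide_simps, simp add: algebra_simps power2_eq_square)
  then show "coeff (pderiv (slegendre (Suc (Suc k))) - pderiv (slegendre k)) j =
      coeff (smult (2 * (2 * real k + 3)) (slegendre (Suc k))) j"
    by (simp add: coeff_pderiv d_def add_ac)
qed

lemma slegendre_ode:
  "pderiv ([:0, 1, -1:] * pderiv (slegendre k)) = smult (- (real k * (real k + 1))) (slegendre k)"
proof (rule poly_eqI)
  fix j
  have "[:0, 1, -1:] * pderiv (slegendre k) = monom 1 1 * pderiv (slegendre k) - monom 1 2 * pderiv (slegendre k)"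
    by (simp add: monom_Suc numeral_2_eq_2 algebra_simps flip: left_diff_distrib)
  hence "coeff ([:0, 1, -1:] * pderiv (slegendre k)) (Suc j) = (real j + 1) * coeff (slegendre k) (Suc j) - real j * coeff (slegendre k) j"
    by (cases j) (simp_all add: coeff_monom_mult coeff_pderiv)
  then have "coeff (pderiv ([:0, 1, -1:] * pderiv (slegendre k))) j
     = (real j + 1) * ((real j + 1) * coeff (slegendre k) (Suc j) - real j * coeff (slegendre k) j)"
    unfolding coeff_pderiv[of "[:0, 1, -1:] * pderiv (slegendre k)"] by (simp del: mult_pCons_left)
  also have "\<dots> = coeff (smult (- (real k * (real k + 1))) (slegendre k)) j"
    using coeff_slegendre_Suc[of j k] by (simp add: algebra_simps power2_eq_square)
  finally show "coeff (pderiv ([:0, 1, -1:] * pderiv (slegendre k))) j = coeff (smult (- (real k * (real k + 1))) (slegendre k)) j" .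
qed

lemma higher_pderiv_pcompose_linear:
  fixes p :: "'a :: idom poly"
  shows "(pderiv ^^ m) (pcompose p [:a, b:]) = smult (b ^ m) (pcompose ((pderiv ^^ m) p) [:a, b:])"
  by (induction m) (simp_all add: pderiv_smult pderiv_pcompose pderiv_pCons mult_ac)

lemma pcompose_power:
  fixes p q :: "'a :: comm_semiring_1 poly"
  shows "pcompose (p ^ k) q = pcompose p q ^ k"
  by (induction k) (simp_all add: pcompose_1 pcompose_mult)

text \<open>After the affine substitution, Rodrigues' formula becomes the \<open>k\<close>-th derivative of
  \<open>x ^ k * (x - 1) ^ k / fact k\<close>, which the binomial theorem expands.\<close>

lemma shifted_legendre_eq: "shifted_legendre k x = poly (slegendre k) x"
proof -
  let ?l = "[:-1, 2:] :: real poly"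
  have "pcompose ([:-1, 0, 1:] ^ k) ?l = ([:-1, 0, 1:] \<circ>\<^sub>p ?l) ^ k"
    by (rule pcompose_power)
  also have "[:-1, 0, 1:] \<circ>\<^sub>p ?l = smult 4 (monom 1 1 * [:-1, 1:])"
    by (simp add: pcompose_pCons monom_Suc)
  finally have 1: "pcompose ([:-1, 0, 1:] ^ k) ?l = smult (4 ^ k) (monom 1 k * [:-1, 1:] ^ k)"
    by (simp only: smult_power power_mult_distrib monom_power) simp
  have 2: "smult (2 ^ k) (pcompose ((pderiv ^^ k) ([:-1, 0, 1:] ^ k)) ?l) = smult (4 ^ k) ((pderiv ^^ k) (monom 1 k * [:-1, 1:] ^ k))"
    using higher_pderiv_pcompose_linear[of k "[:-1, 0, 1:] ^ k" "-1" "2::real"]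
    by (simp add: 1 higher_pderiv_smult)
  have 3: "(pderiv ^^ k) (monom 1 k * [:-1, 1:] ^ k) = smult (fact k) (slegendre k)"
  proof (rule poly_eqI)
    fix j
    show "coeff ((pderiv ^^ k) (monom 1 k * [:-1, 1:] ^ k)) j = coeff (smult (fact k) (slegendre k)) j"
    proof (cases "j \<le> k")
      case True
      have p1: "pochhammer (real (Suc j)) k = fact (k + j) / fact j"
        using pochhammer_product'[of "1::real" j k]
        by (simp add: pochhammer_fact[symmetric] add_ac)
      have p2: "pochhammer (real k - real j + 1) (2 * j) = fact (k + j) / fact (k - j)"
        using pochhammer_product'[of "1::real" "k - j" "2 * j"] True
        by (simp add: pochhammer_fact[symmetric] add_ac of_nat_diff)
      have "(-1::real) ^ (k + j) = (-1) ^ (k - j)" using True by (simp add: minus_one_power_iff)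
      then show ?thesis using True
        unfolding coeff_higher_pderiv coeff_monom_mult coeff_smult coeff_slegendre p1 p2 coeff_linear_poly_power
        by (simp add: coeff_linear_poly_power binomial_fact field_simps power2_eq_square)
    next
      case False
      then show ?thesis 
        by (simp add: coeff_higher_pderiv coeff_monom_mult coeff_eq_0 degree_linear_power slegendre_def coeff_sum)
    qed
  qed
  have "2 ^ k * poly ((pderiv ^^ k) ([:-1, 0, 1:] ^ k)) (2 * x - 1) = 4 ^ k * fact k * poly (slegendre k) x"
    using arg_cong[OF 2, of "\<lambda>p. poly p x"] by (simp add: 3 poly_pcompose algebra_simps)
  moreover have "(4::real) ^ k = 2 ^ k * 2 ^ k" by (simp flip: power_mult_distrib)
  ultimately show ?thesis
    by (simp add: shifted_legendre_def legendre_def field_simps)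
qed

section \<open>Orthogonality, norm and size\<close>

lemma degree_slegendre [simp]: "degree (slegendre k) = k"
proof (rule antisym)
  show "degree (slegendre k) \<le> k"
    by (rule degree_le) (simp add: slegendre_def coeff_sum)
  show "k \<le> degree (slegendre k)"
    by (rule le_degree) (simp add: coeff_slegendre pochhammer_fact[symmetric])
qed

lemma lead_coeff_slegendre: "coeff (slegendre k) k \<noteq> 0"
  by (simp add: coeff_slegendre pochhammer_fact[symmetric])

lemma slegendre_0 [simp]: "slegendre 0 = 1"
  by (simp add: slegendre_def monom_0 one_pCons)

lemma slegendre_1 [simp]: "slegendre (Suc 0) = [:-1, 2:]"
  by (simp add: slegendre_def monom_0 monom_Suc pochhammer_fact[symmetric] fact_numeral numeral_2_eq_2 pochhammer_Suc)

lemma poly_slegendre_0: "poly (slegendre k) 0 = (-1) ^ k"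
  by (simp add: poly_0_coeff_0 coeff_slegendre)

text \<open>The lower limit varies because both inner products on \<open>[0, 1]\<close> (as \<open>integral_to_1 0 (p * q)\<close>) and the
  coefficients of a step at \<open>x\<close> (as \<open>integral_to_1 x p\<close>) are of this form.\<close>

definition integral_to_1 :: "real \<Rightarrow> real poly \<Rightarrow> real" where
  "integral_to_1 x p = integral {x..1} (poly p)"

lemma poly_integrable: "poly p integrable_on {x..1::real}"
  by (intro integrable_continuous_interval continuous_intros)

lemma integral_to_1_add: "integral_to_1 x (p + q) = integral_to_1 x p + integral_to_1 x q"
proof -
  have "poly (p + q) = (\<lambda>s. poly p s + poly q s)" by auto
  then show ?thesis unfolding integral_to_1_def by (simp add: integral_add poly_integrable)
qed

lemma integral_to_1_smult: "integral_to_1 x (smult c p) = c * integral_to_1 x p"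
proof -
  have "poly (smult c p) = (\<lambda>s. c * poly p s)" by auto
  then show ?thesis unfolding integral_to_1_def by simp
qed

lemma integral_to_1_0 [simp]: "integral_to_1 x 0 = 0"
  using integral_to_1_smult[of x 0 0] by simp

lemma integral_to_1_sum: "integral_to_1 x (\<Sum>i\<in>A. f i) = (\<Sum>i\<in>A. integral_to_1 x (f i))"
  by (induction A rule: infinite_finite_induct) (simp_all add: integral_to_1_add)

lemma integral_to_1_pderiv:
  assumes "x \<le> 1"
  shows "integral_to_1 x (pderiv p) = poly p 1 - poly p x"
proof -
  have "(poly (pderiv p) has_integral poly p 1 - poly p x) {x..1}"
    using assms
    by (rule fundamental_theorem_of_calculus)
       (auto simp flip: has_real_derivative_iff_has_vector_derivative intro: has_field_derivative_at_within[OF poly_DERIV])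
  then show ?thesis by (simp add: integral_to_1_def integral_unique)
qed

lemma integral_to_1_1: "x \<le> 1 \<Longrightarrow> integral_to_1 x 1 = 1 - x"
  using integral_to_1_pderiv[of x "[:0, 1:]"] by (simp add: pderiv_pCons one_pCons)

text \<open>Legendre's operator is symmetric: \<open>x (1 - x)\<close> times the Wronskian has the product of the two
  polynomials, up to the difference of the eigenvalues, as its derivative, and it vanishes at both
  end points.\<close>

lemma slegendre_orthogonal:
  assumes "k \<noteq> m"
  shows "integral_to_1 0 (slegendre k * slegendre m) = 0"
proof -
  define w :: "real poly" where "w = [:0, 1, -1:]"
  let ?P = "slegendre k" and ?R = "slegendre m"
  have "pderiv ((w * pderiv ?P) * ?R - (w * pderiv ?R) * ?P)
      = smult (real m * (real m + 1) - real k * (real k + 1)) (?P * ?R)"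
    unfolding pderiv_diff pderiv_mult[of "w * _"] slegendre_ode[folded w_def]
    by (simp add: algebra_simps smult_diff_left smult_add_left)
  from arg_cong[OF this, of "integral_to_1 0"]
  have "(real m * (real m + 1) - real k * (real k + 1)) * integral_to_1 0 (?P * ?R) = 0"
    by (simp add: integral_to_1_pderiv integral_to_1_smult w_def)
  moreover have "real m * (real m + 1) \<noteq> real k * (real k + 1)"
  proof -
    have "m * (m + 1) \<noteq> k * (k + 1)"
    proof (cases "m < k")
      case True
      then have "m * (m + 1) < k * (k + 1)" by (intro mult_strict_mono) auto
      then show ?thesis by simp
    next
      case False
      then have "k * (k + 1) < m * (m + 1)" using assms by (intro mult_strict_mono) auto
      then show ?thesis by simp
    qed
    then show ?thesis
      by (metis of_nat_1 of_nat_add of_nat_eq_iff of_nat_mult)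
  qed
  ultimately show ?thesis by simp
qed

lemma slegendre_span:
  assumes "degree q \<le> N"
  shows "\<exists>c. q = (\<Sum>i\<le>N. smult (c i) (slegendre i))"
  using assms
proof (induction N arbitrary: q)
  case 0
  then obtain a where "q = [:a:]" by (auto elim: degree_eq_zeroE)
  then have "q = smult a (slegendre 0)" by simp
  then show ?case by (intro exI[of _ "\<lambda>_. a"]) simp
next
  case (Suc N)
  define a where "a = coeff q (Suc N) / coeff (slegendre (Suc N)) (Suc N)"
  have "degree (q - smult a (slegendre (Suc N))) \<le> N"
  proof (rule degree_le, intro allI impI)
    fix i assume "N < i"
    show "coeff (q - smult a (slegendre (Suc N))) i = 0"
    proof (cases "i = Suc N")
      case True
      then show ?thesis using lead_coeff_slegendre[of "Suc N"] by (simp add: a_def)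
    next
      case False
      with \<open>N < i\<close> have "Suc N < i" by simp
      then show ?thesis using Suc.prems by (simp add: coeff_eq_0)
    qed
  qed
  from Suc.IH[OF this] obtain c where c: "q - smult a (slegendre (Suc N)) = (\<Sum>i\<le>N. smult (c i) (slegendre i))"
    by blast
  have "(\<Sum>i\<le>N. smult (c i) (slegendre i)) = (\<Sum>i\<le>N. smult ((c(Suc N := a)) i) (slegendre i))"
    by (intro sum.cong) auto
  then have "q = (\<Sum>i\<le>Suc N. smult ((c(Suc N := a)) i) (slegendre i))"
    using c by (simp add: diff_eq_eq)
  then show ?case by blast
qed

lemma slegendre_orthogonal_lower:
  assumes "degree q < k"
  shows "integral_to_1 0 (q * slegendre k) = 0"
proof -
  obtain c where q: "q = (\<Sum>i\<le>degree q. smult (c i) (slegendre i))"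
    using slegendre_span[of q "degree q"] by blast
  have "integral_to_1 0 (q * slegendre k) = (\<Sum>i\<le>degree q. c i * integral_to_1 0 (slegendre i * slegendre k))"
    by (subst q) (simp add: sum_distrib_right integral_to_1_sum integral_to_1_smult)
  also have "\<dots> = 0" using assms by (intro sum.neutral) (auto simp: slegendre_orthogonal)
  finally show ?thesis .
qed

text \<open>Two polynomials whose indices differ by 2 agree at 1, since the derivative of their difference
  is a multiple of a polynomial that is orthogonal to the constants, and they agree at 0.\<close>

lemma poly_slegendre_1: "poly (slegendre k) 1 = 1"
proof (induction k rule: less_induct)
  case (less k)
  consider "k = 0" | "k = 1" | m where "k = Suc (Suc m)"
    by (metis One_nat_def not0_implies_Suc)
  then show ?case
  proof cases
    case 3
    have "integral_to_1 0 (slegendre (Suc m)) = 0"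
      using slegendre_orthogonal[of 0 "Suc m"] by simp
    then have "integral_to_1 0 (pderiv (slegendre (Suc (Suc m)) - slegendre m)) = 0"
      by (simp add: pderiv_diff pderiv_slegendre integral_to_1_smult)
    then have "poly (slegendre k) 1 - poly (slegendre m) 1 = 0"
      by (simp add: 3 integral_to_1_pderiv poly_slegendre_0)
    with less[of m] 3 show ?thesis by simp
  qed auto
qed

text \<open>Integrating \<open>P\<^sub>m\<^sub>+\<^sub>1 (P\<^sub>m\<^sub>+\<^sub>2 - P\<^sub>m)'\<close> by parts leaves the integral of \<open>P\<^sub>m\<^sub>+\<^sub>1' P\<^sub>m\<close>, and modulo lower
  degrees \<open>P\<^sub>m\<^sub>+\<^sub>1'\<close> is \<open>2 (2 m + 1) P\<^sub>m\<close>. So the left-hand side does not depend on the index.\<close>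

lemma slegendre_norm: "(2 * real k + 1) * integral_to_1 0 (slegendre k * slegendre k) = 1"
proof (induction k)
  case 0
  show ?case by (simp add: integral_to_1_1)
next
  case (Suc m)
  let ?P = "slegendre (Suc m)" and ?D = "slegendre (Suc (Suc m)) - slegendre m"
  have "2 * (2 * real m + 3) * integral_to_1 0 (?P * ?P) = integral_to_1 0 (?P * pderiv ?D)"
    by (simp add: pderiv_diff pderiv_slegendre integral_to_1_smult)
  also have "\<dots> = integral_to_1 0 (pderiv (?P * ?D)) - integral_to_1 0 (pderiv ?P * ?D)"
    unfolding pderiv_mult by (simp add: integral_to_1_add mult.commute)
  also have "integral_to_1 0 (pderiv (?P * ?D)) = 0"
    by (simp add: integral_to_1_pderiv poly_slegendre_0 poly_slegendre_1)
  also have "integral_to_1 0 (pderiv ?P * ?D) = integral_to_1 0 (pderiv ?P * slegendre (Suc (Suc m))) + integral_to_1 0 (smult (-1) (pderiv ?P * slegendre m))"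
    by (simp add: algebra_simps flip: integral_to_1_add)
  also have "integral_to_1 0 (pderiv ?P * slegendre (Suc (Suc m))) = 0"
    by (rule slegendre_orthogonal_lower) (simp add: degree_pderiv)
  also have "integral_to_1 0 (smult (-1) (pderiv ?P * slegendre m)) = (-1) * integral_to_1 0 (pderiv ?P * slegendre m)"
    by (simp only: integral_to_1_smult)
  also have "integral_to_1 0 (pderiv ?P * slegendre m) = 2 * (2 * real m + 1) * integral_to_1 0 (slegendre m * slegendre m)"
  proof (cases m)
    case 0
    have "pderiv ?P = smult 2 1" by (simp add: 0 pderiv_pCons one_pCons)
    then show ?thesis by (simp only: mult_smult_left integral_to_1_smult) (simp add: 0 integral_to_1_1)
  next
    case (Suc l)
    have "pderiv ?P = smult (2 * (2 * real m + 1)) (slegendre m) + pderiv (slegendre l)"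
    proof -
      have "2 * (2 * real l + 3) = 2 * (2 * real m + 1)" by (simp add: Suc)
      with pderiv_slegendre[of l] show ?thesis by (simp only: Suc diff_eq_eq)
    qed
    moreover have "integral_to_1 0 (pderiv (slegendre l) * slegendre m) = 0"
      by (rule slegendre_orthogonal_lower) (simp add: degree_pderiv Suc)
    ultimately show ?thesis by (simp only: ring_distribs integral_to_1_add mult_smult_left integral_to_1_smult)
  qed
  finally show ?case using Suc.IH by (simp add: algebra_simps)
qed

lemma integral_to_1_slegendre_Suc:
  assumes "x \<le> 1"
  shows "2 * (2 * real k + 3) * integral_to_1 x (slegendre (Suc k)) = poly (slegendre k) x - poly (slegendre (Suc (Suc k))) x"
proof -
  have "2 * (2 * real k + 3) * integral_to_1 x (slegendre (Suc k)) = integral_to_1 x (pderiv (slegendre (Suc (Suc k)) - slegendre k))"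
    by (simp add: pderiv_diff pderiv_slegendre integral_to_1_smult)
  then show ?thesis using assms by (simp add: integral_to_1_pderiv poly_slegendre_1)
qed

text \<open>An energy argument, for \<open>k \<ge> 1\<close>: \<open>P\<^sup>2 + x (1 - x) P'\<^sup>2 / (k (k + 1))\<close> dominates \<open>P\<^sup>2\<close>, and by the differential
  equation its derivative has the sign of \<open>2 x - 1\<close>. Hence its maximum is at an end point, where
  it equals 1.\<close>

lemma abs_poly_slegendre_le_1:
  assumes "x \<in> {0..1}"
  shows "\<bar>poly (slegendre k) x\<bar> \<le> 1"
proof (cases "k = 0")
  case False
  define \<kappa> where "\<kappa> = real k * (real k + 1)"
  have \<kappa>: "\<kappa> > 0" using False by (simp add: \<kappa>_def)
  \<comment> \<open>\<open>h\<close> is the energy, \<open>w\<close> the polynomial \<open>x * (1 - x)\<close>.\<close>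
  define w :: "real poly" where "w = [:0, 1, -1:]"
  define P where "P = slegendre k"
  define h where "h = P * P + smult (1 / \<kappa>) (w * pderiv P * pderiv P)"
  have w': "poly (pderiv w) s = 1 - 2 * s" for s by (simp add: w_def pderiv_pCons)
  have ode: "poly (w * pderiv (pderiv P)) s = - \<kappa> * poly P s - (1 - 2 * s) * poly (pderiv P) s" for s
  proof -
    have "poly (pderiv (w * pderiv P)) s = - \<kappa> * poly P s"
      using slegendre_ode[of k] by (simp add: w_def P_def \<kappa>_def)
    then show ?thesis unfolding pderiv_mult by (simp add: w' algebra_simps)
  qed
  have h': "poly (pderiv h) s = (2 * s - 1) * (poly (pderiv P) s)\<^sup>2 / \<kappa>" for s
  proof -
    have "poly (pderiv h) s = 2 * poly P s * poly (pderiv P) s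
       + ((1 - 2 * s) * (poly (pderiv P) s)\<^sup>2 + 2 * poly (w * pderiv (pderiv P)) s * poly (pderiv P) s) / \<kappa>"
      unfolding h_def pderiv_add pderiv_mult pderiv_smult
      by (simp add: w' field_simps power2_eq_square)
    also have "\<dots> = (2 * s - 1) * (poly (pderiv P) s)\<^sup>2 / \<kappa>"
      unfolding ode using \<kappa> by (simp add: field_simps power2_eq_square)
    finally show ?thesis .
  qed
  have "poly h x \<le> 1"
  proof (cases "x \<le> 1 / 2")
    case True
    have "poly h x \<le> poly h 0"
    proof (rule DERIV_nonpos_imp_nonincreasing[where f = "poly h"])
      show "0 \<le> x" using assms by simp
      fix s assume "0 \<le> s" "s \<le> x"
      then have "poly (pderiv h) s \<le> 0"
        unfolding h' using True \<kappa> by (intro divide_nonpos_pos mult_nonpos_nonneg) auto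
      then show "\<exists>y. DERIV (poly h) s :> y \<and> y \<le> 0" using poly_DERIV by blast
    qed
    also have "\<dots> = 1" by (simp add: h_def w_def P_def poly_slegendre_0 flip: power_mult_distrib)
    finally show ?thesis .
  next
    case False
    have "poly h x \<le> poly h 1"
    proof (rule DERIV_nonneg_imp_nondecreasing[where f = "poly h"])
      show "x \<le> 1" using assms by simp
      fix s assume "x \<le> s" "s \<le> 1"
      then have "0 \<le> poly (pderiv h) s"
        unfolding h' using False \<kappa> by (intro divide_nonneg_pos mult_nonneg_nonneg) auto
      then show "\<exists>y. DERIV (poly h) s :> y \<and> y \<ge> 0" using poly_DERIV by blast
    qed
    also have "\<dots> = 1" by (simp add: h_def w_def P_def poly_slegendre_1)
    finally show ?thesis .
  qed
  moreover have "poly w x * (poly (pderiv P) x)\<^sup>2 / \<kappa> \<ge> 0"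
  proof -
    have "poly w x = x * (1 - x)" by (simp add: w_def algebra_simps)
    then show ?thesis using assms \<kappa> by simp
  qed
  ultimately have "(poly P x)\<^sup>2 \<le> 1"
    by (simp add: h_def power2_eq_square mult_ac)
  then show ?thesis by (simp add: P_def abs_square_le_1)
qed auto

section \<open>Least-squares approximation of a unit step\<close>

text \<open>The squared distance in mean square on \<open>[0, 1]\<close> between \<open>q\<close> and the step \<open>indicator {x<..}\<close>, with the square
  expanded; the lemma below justifies the name. In this form it depends on \<open>q\<close> algebraically.\<close>

definition step_err :: "real \<Rightarrow> real poly \<Rightarrow> real" where
  "step_err x q = 1 - x - 2 * integral_to_1 x q + integral_to_1 0 (q * q)"

lemma step_err_has_integral:
  assumes "x \<in> {0..1}"
  shows "((\<lambda>s. (indicator {x<..} s - poly q s)\<^sup>2) has_integral step_err x q) {0..1}"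
proof -
  have 1: "(poly (q * q) has_integral integral_to_1 0 (q * q)) {0..1}"
    unfolding integral_to_1_def by (rule integrable_integral[OF poly_integrable])
  have "integral_to_1 x (1 + smult (-2) q) = 1 - x - 2 * integral_to_1 x q"
    using assms unfolding integral_to_1_add integral_to_1_smult by (simp add: integral_to_1_1)
  then have "(poly (1 - smult 2 q) has_integral (1 - x - 2 * integral_to_1 x q)) {x..1}"
    using integrable_integral[OF poly_integrable[of "1 - smult 2 q" x]] by (simp add: integral_to_1_def)
  then have "((\<lambda>s. if s \<in> {x..1} then poly (1 - smult 2 q) s else 0) has_integral (1 - x - 2 * integral_to_1 x q)) {0..1}"
    using assms by (subst has_integral_restrict) (auto simp: integral_to_1_add integral_to_1_smult integral_to_1_1)
  from has_integral_add[OF this 1]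
  have "((\<lambda>s. (if s \<in> {x..1} then poly (1 - smult 2 q) s else 0) + poly (q * q) s)
      has_integral step_err x q) {0..1}"
    by (simp add: step_err_def)
  then show ?thesis
    by (rule has_integral_spike_finite[of "{x}", rotated 2])
       (auto simp: power2_eq_square algebra_simps split: split_indicator)
qed

definition step_proj :: "real \<Rightarrow> nat \<Rightarrow> real poly" where
  "step_proj x N = (\<Sum>k\<le>N. smult ((2 * real k + 1) * integral_to_1 x (slegendre k)) (slegendre k))"

lemma step_err_slegendre_sum:
  "step_err x (\<Sum>i\<le>N. smult (c i) (slegendre i)) =
     1 - x + (\<Sum>i\<le>N. (c i)\<^sup>2 / (2 * real i + 1) - 2 * c i * integral_to_1 x (slegendre i))"
proof -
  let ?q = "\<Sum>i\<le>N. smult (c i) (slegendre i)"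
  have norm: "integral_to_1 0 (slegendre i * slegendre i) = 1 / (2 * real i + 1)" for i
    using slegendre_norm[of i] by (simp add: field_simps)
  have "integral_to_1 0 (?q * ?q) = (\<Sum>i\<le>N. \<Sum>j\<le>N. c i * (c j * integral_to_1 0 (slegendre i * slegendre j)))"
    by (simp add: sum_product integral_to_1_sum integral_to_1_smult mult_ac)
  also have "\<dots> = (\<Sum>i\<le>N. \<Sum>j\<le>N. if j = i then (c i)\<^sup>2 / (2 * real i + 1) else 0)"
    by (intro sum.cong refl) (auto simp: norm slegendre_orthogonal power2_eq_square)
  finally have "integral_to_1 0 (?q * ?q) = (\<Sum>i\<le>N. (c i)\<^sup>2 / (2 * real i + 1))"
    by simp
  moreover have "integral_to_1 x ?q = (\<Sum>i\<le>N. c i * integral_to_1 x (slegendre i))"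
    by (simp add: integral_to_1_sum integral_to_1_smult)
  ultimately show ?thesis
    by (simp add: step_err_def sum_subtractf sum_distrib_left mult_ac)
qed

text \<open>In the Legendre basis the error is a sum of one-variable quadratics, and each of them is minimal
  at the coefficient chosen in \<open>step_proj\<close>.\<close>

lemma step_proj_best:
  assumes "degree q \<le> N"
  shows "step_err x (step_proj x N) \<le> step_err x q"
proof -
  obtain c where q: "q = (\<Sum>i\<le>N. smult (c i) (slegendre i))"
    using slegendre_span[OF assms] by blast
  show ?thesis
    unfolding q step_proj_def step_err_slegendre_sum
  proof (intro add_left_mono sum_mono)
    fix i
    define d where "d = integral_to_1 x (slegendre i)"
    define t where "t = 2 * real i + 1"
    have t: "t > 0" by (simp add: t_def)
    have "0 \<le> (c i - t * d)\<^sup>2 / t" using t by simp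
    also have "\<dots> = (c i)\<^sup>2 / t - 2 * c i * d - ((t * d)\<^sup>2 / t - 2 * (t * d) * d)"
      using t by (simp add: field_simps power2_eq_square)
    finally show "((2 * real i + 1) * integral_to_1 x (slegendre i))\<^sup>2 / (2 * real i + 1) - 2 * ((2 * real i + 1) * integral_to_1 x (slegendre i)) * integral_to_1 x (slegendre i)
        \<le> (c i)\<^sup>2 / (2 * real i + 1) - 2 * c i * integral_to_1 x (slegendre i)"
      by (simp add: d_def t_def)
  qed
qed

lemma weierstrass_poly:
  fixes h :: "real \<Rightarrow> real"
  assumes "continuous_on {0..1} h" "0 < e"
  shows "\<exists>q. \<forall>s\<in>{0..1}. \<bar>h s - poly q s\<bar> < e"
proof -
  obtain N where N: "\<And>n x. N \<le> n \<Longrightarrow> x \<in> {0..1} \<Longrightarrow> \<bar>h x - (\<Sum>k\<le>n. h (k / n) * Bernstein n k x)\<bar> < e"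
    using Bernstein_Weierstrass[OF assms] by blast
  define q where "q = (\<Sum>k\<le>N. smult (h (k / N) * real (N choose k)) (monom 1 k * [:1, -1:] ^ (N - k)))"
  have "poly q s = (\<Sum>k\<le>N. h (k / N) * Bernstein N k s)" for s
    unfolding q_def poly_sum by (intro sum.cong refl) (simp add: Bernstein_def poly_monom poly_power)
  then show ?thesis using N[of N] by (intro exI[of _ q]) simp
qed

text \<open>The step is first replaced by a ramp of width \<open>\<delta>\<close>, which differs from it by at most 1 and only on an
  interval of length \<open>\<delta>\<close>; the ramp is continuous and can be approximated uniformly.\<close>

lemma step_err_small:
  assumes x: "x \<in> {0..1}" and e: "0 < e"
  shows "\<exists>q. step_err x q < e"
proof -
  \<comment> \<open>The error is at most \<open>2 * \<delta> + 2 * \<eta>\<^sup>2\<close>, which these choices make \<open>e / 2\<close>.\<close>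
  define \<delta> where "\<delta> = e / 8"
  define \<eta> where "\<eta> = sqrt (e / 8)"
  have \<delta>: "\<delta> > 0" and \<eta>: "\<eta> > 0" "\<eta>\<^sup>2 = e / 8" using e by (auto simp: \<delta>_def \<eta>_def)
  define h where "h s = max 0 (min 1 ((s - x) / \<delta>))" for s
  have "continuous_on {0..1} h"
    unfolding h_def using \<delta> by (intro continuous_intros) auto
  from weierstrass_poly[OF this \<eta>(1)]
  obtain q where q: "\<And>s. s \<in> {0..1} \<Longrightarrow> \<bar>h s - poly q s\<bar> < \<eta>" by blast
  define y where "y = min 1 (x + \<delta>)"
  have xy: "x \<le> y" "y \<le> 1" "y - x \<le> \<delta>" using x \<delta> by (auto simp: y_def)
  have "((\<lambda>s. if s \<in> {x..y} then 2 else 0) has_integral (2 * (y - x))) {0..1}"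
    using x xy has_integral_const_real[of "2::real" x y]
    by (subst has_integral_restrict) (auto simp: mult.commute)
  moreover have "((\<lambda>s. 2 * \<eta>\<^sup>2) has_integral (2 * \<eta>\<^sup>2)) {0..1::real}"
    using has_integral_const_real[of "2 * \<eta>\<^sup>2" 0 1] by simp
  ultimately have I: "((\<lambda>s. (if s \<in> {x..y} then 2 else 0) + 2 * \<eta>\<^sup>2) has_integral (2 * (y - x) + 2 * \<eta>\<^sup>2)) {0..1}"
    by (rule has_integral_add)
  have "step_err x q \<le> 2 * (y - x) + 2 * \<eta>\<^sup>2"
  proof (rule has_integral_le[OF step_err_has_integral[OF x] I])
    fix s :: real assume s: "s \<in> {0..1}"
    define u where "u = indicator {x<..} s - h s"
    define v where "v = h s - poly q s"
    have u: "u\<^sup>2 \<le> (if s \<in> {x..y} then 1 else 0)"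
    proof (cases "s \<in> {x..y}")
      case True
      have "0 \<le> h s" "h s \<le> 1" by (auto simp: h_def)
      then have "\<bar>u\<bar> \<le> 1" by (auto simp: u_def split: split_indicator)
      then show ?thesis using True by (simp add: abs_square_le_1)
    next
      case False
      then consider "s < x" | "s > x + \<delta>" using s by (auto simp: y_def min_def split: if_splits)
      then have "u = 0"
      proof cases
        case 1
        then have "(s - x) / \<delta> < 0" using \<delta> by (simp add: divide_neg_pos)
        with 1 show ?thesis by (simp add: u_def h_def)
      next
        case 2
        then have "(s - x) / \<delta> > 1" using \<delta> by simp
        with 2 \<delta> show ?thesis by (simp add: u_def h_def)
      qed
      then show ?thesis by simp
    qed
    have "\<bar>v\<bar> \<le> \<eta>" using q[OF s] by (simp add: v_def)
    then have v: "v\<^sup>2 \<le> \<eta>\<^sup>2" using \<eta> by (simp add: abs_le_square_iff[symmetric])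
    have "(indicator {x<..} s - poly q s)\<^sup>2 = (u + v)\<^sup>2" by (simp add: u_def v_def)
    also have "\<dots> \<le> 2 * u\<^sup>2 + 2 * v\<^sup>2" using zero_le_power2[of "u - v"] by (simp add: power2_sum power2_diff)
    also have "\<dots> \<le> (if s \<in> {x..y} then 2 else 0) + 2 * \<eta>\<^sup>2"
      using u v by (auto split: if_splits)
    finally show "(indicator {x<..} s - poly q s)\<^sup>2 \<le> (if s \<in> {x..y} then 2 else 0) + 2 * \<eta>\<^sup>2" .
  qed
  also have "\<dots> < e" using xy \<eta>(2) e by (simp add: \<delta>_def)
  finally show ?thesis by blast
qed

lemma step_err_nonneg:
  assumes "x \<in> {0..1}" shows "0 \<le> step_err x q"
  using has_integral_nonneg[OF step_err_has_integral[OF assms]] by simp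

lemma step_proj_tendsto:
  assumes x: "x \<in> {0..1}"
  shows "(\<lambda>N. step_err x (step_proj x N)) \<longlonglongrightarrow> 0"
proof (rule order_tendstoI)
  fix a :: real assume "a < 0"
  then show "\<forall>\<^sub>F N in sequentially. a < step_err x (step_proj x N)"
    using step_err_nonneg[OF x] by (intro always_eventually allI) (rule less_le_trans)
next
  fix e :: real assume "0 < e"
  from step_err_small[OF x this] obtain q where q: "step_err x q < e" by blast
  show "\<forall>\<^sub>F N in sequentially. step_err x (step_proj x N) < e"
    using eventually_ge_at_top[of "degree q"]
    by eventually_elim (use q step_proj_best in \<open>blast intro: le_less_trans\<close>)
qed

section \<open>Legendre series of a distribution tail\<close>

text \<open>The primitive that vanishes at 0; up to the sign \<open>(-1) ^ k\<close>, its expectation at \<open>V\<close> is the inner sum of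
  the theorem.\<close>

definition slegendre_prim :: "nat \<Rightarrow> real poly" where
  "slegendre_prim k = (\<Sum>j\<le>k. monom (coeff (slegendre k) j / real (j + 1)) (j + 1))"

lemma pderiv_slegendre_prim: "pderiv (slegendre_prim k) = slegendre k"
proof -
  have "pderiv (slegendre_prim k) = (\<Sum>j\<le>k. monom (coeff (slegendre k) j) j)"
    using higher_pderiv_sum[of 1 "\<lambda>j. monom (coeff (slegendre k) j / real (j + 1)) (j + 1)" "{..k}"]
    by (simp add: slegendre_prim_def pderiv_monom add.commute)
  also have "\<dots> = slegendre k" by (metis poly_as_sum_of_monoms degree_slegendre)
  finally show ?thesis .
qed

lemma poly_slegendre_prim_0: "poly (slegendre_prim k) 0 = 0"
  by (simp add: slegendre_prim_def poly_sum poly_monom)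

lemma slegendre_prim_0: "poly (slegendre_prim 0) s = s"
  by (simp add: slegendre_prim_def poly_monom)

text \<open>Both sides have the same derivative and vanish at 0.\<close>

lemma slegendre_prim_Suc:
  "2 * (2 * real k + 3) * poly (slegendre_prim (Suc k)) s = poly (slegendre (Suc (Suc k))) s - poly (slegendre k) s"
proof -
  define D where "D = smult (2 * (2 * real k + 3)) (slegendre_prim (Suc k)) - (slegendre (Suc (Suc k)) - slegendre k)"
  have "pderiv D = 0"
    by (simp add: D_def pderiv_diff pderiv_smult pderiv_slegendre_prim pderiv_slegendre)
  then obtain a where "D = [:a:]" by (auto simp: pderiv_eq_0_iff elim: degree_eq_zeroE)
  moreover have "poly D 0 = 0"
    by (simp add: D_def poly_slegendre_prim_0 poly_slegendre_0)
  ultimately have "poly D s = 0" by simp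
  then show ?thesis by (simp add: D_def)
qed

lemma poly_bounded_01: "\<exists>B. \<forall>s\<in>{0..1::real}. \<bar>poly p s\<bar> \<le> B"
proof -
  have "bounded (poly p ` {0..1})"
    by (intro compact_imp_bounded compact_continuous_image continuous_intros) auto
  then show ?thesis by (auto simp: bounded_iff)
qed

lemma poly_borel_measurable [measurable]: "poly p \<in> borel_measurable (borel :: real measure)"
  by (intro borel_measurable_continuous_onI continuous_intros)

context prob_space
begin

text \<open>The Cauchy--Schwarz inequality for the density and \<open>g\<close>, in the additive form with a free parameter
  \<open>t\<close>; letting \<open>t\<close> depend on the required accuracy replaces taking square roots.\<close>

lemma expectation_L2_bound:
  assumes D: "distributed M lborel V (\<lambda>s. ennreal (f s))"
    and f: "\<And>s. 0 \<le> f s" "integrable lborel (\<lambda>s. (f s)\<^sup>2)"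
    and V: "AE \<omega> in M. V \<omega> \<in> {0..1}"
    and g [measurable]: "(g :: real \<Rightarrow> real) \<in> borel_measurable borel"
    and B: "\<And>s. s \<in> {0..1} \<Longrightarrow> \<bar>g s\<bar> \<le> B"
    and E: "((\<lambda>s. (g s)\<^sup>2) has_integral E) {0..1}"
    and t: "0 < t"
  shows "2 * \<bar>expectation (\<lambda>\<omega>. g (V \<omega>))\<bar> \<le> t * (LINT s|lborel. (f s)\<^sup>2) + E / t"
proof -
  have V_meas [measurable]: "V \<in> borel_measurable M"
    using distributed_measurable[OF D] by simp
  have f_meas [measurable]: "f \<in> borel_measurable borel"
    using distributed_real_measurable[OF _ D] f by simp
  define g0 where "g0 s = indicator {0..1} s * g s" for s :: real
  have [measurable]: "g0 \<in> borel_measurable borel" unfolding g0_def by measurable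
  have "set_integrable lborel {0..1} (\<lambda>s. (g s)\<^sup>2)"
    unfolding set_integrable_def
  proof (rule Bochner_Integration.integrable_bound)
    show "integrable lborel (\<lambda>s. B\<^sup>2 * indicator {0..1::real} s)" by simp
    show "AE s in lborel. norm (indicator {0..1} s *\<^sub>R (g s)\<^sup>2) \<le> norm (B\<^sup>2 * indicator {0..1} s)"
    proof (rule AE_I2)
      fix s :: real
      show "norm (indicator {0..1} s *\<^sub>R (g s)\<^sup>2) \<le> norm (B\<^sup>2 * indicator {0..1} s)"
        using power_mono[OF B[of s] abs_ge_zero, of 2] by (auto split: split_indicator)
    qed
  qed simp
  moreover have g0_sq: "(g0 s)\<^sup>2 = indicator {0..1} s *\<^sub>R (g s)\<^sup>2" for s
    by (simp add: g0_def power2_eq_square split: split_indicator)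
  ultimately have g0_int: "integrable lborel (\<lambda>s. (g0 s)\<^sup>2)" "(LINT s|lborel. (g0 s)\<^sup>2) = E"
    using set_borel_integral_eq_integral(2)[of "{0..1}" "\<lambda>s. (g s)\<^sup>2"] integral_unique[OF E]
    by (simp_all add: set_integrable_def set_lebesgue_integral_def)
  have amgm: "2 * \<bar>f s * g0 s\<bar> \<le> t * (f s)\<^sup>2 + (g0 s)\<^sup>2 / t" for s
  proof -
    have "0 \<le> (t * f s - \<bar>g0 s\<bar>)\<^sup>2 / t" using t by simp
    also have "\<dots> = t * (f s)\<^sup>2 + (g0 s)\<^sup>2 / t - 2 * \<bar>f s * g0 s\<bar>"
      using t f(1)[of s] by (simp add: power2_diff abs_mult add_divide_distrib diff_divide_distrib power_mult_distrib) (simp add: power2_eq_square)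
    finally show ?thesis by simp
  qed
  have dom: "integrable lborel (\<lambda>s. t * (f s)\<^sup>2 + (g0 s)\<^sup>2 / t)"
    using f(2) g0_int(1) by simp
  have fg: "integrable lborel (\<lambda>s. f s * g0 s)"
  proof (rule Bochner_Integration.integrable_bound[OF dom], measurable, rule AE_I2)
    fix s
    show "norm (f s * g0 s) \<le> norm (t * (f s)\<^sup>2 + (g0 s)\<^sup>2 / t)"
      using amgm[of s] unfolding real_norm_def by linarith
  qed
  have "expectation (\<lambda>\<omega>. g (V \<omega>)) = expectation (\<lambda>\<omega>. g0 (V \<omega>))"
    using V by (intro integral_cong_AE) (auto simp: g0_def elim: eventually_mono)
  also have "\<dots> = (LINT s|lborel. f s * g0 s)"
    by (rule distributed_integral[OF D, symmetric]) (use f in auto)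
  finally have "2 * \<bar>expectation (\<lambda>\<omega>. g (V \<omega>))\<bar> \<le> (LINT s|lborel. 2 * \<bar>f s * g0 s\<bar>)"
    using integral_abs_bound[of lborel "\<lambda>s. f s * g0 s"] by simp
  also have "\<dots> \<le> (LINT s|lborel. t * (f s)\<^sup>2 + (g0 s)\<^sup>2 / t)"
    using fg dom amgm by (intro integral_mono) auto
  also have "\<dots> = t * (LINT s|lborel. (f s)\<^sup>2) + E / t"
    using f(2) g0_int by simp
  finally show ?thesis .
qed

lemma integrable_poly:
  fixes p :: "real poly"
  assumes [measurable]: "V \<in> borel_measurable M" and V: "AE \<omega> in M. V \<omega> \<in> {0..1}"
  shows "integrable M (\<lambda>\<omega>. poly p (V \<omega>))"
proof -
  obtain B where "\<And>s. s \<in> {0..1} \<Longrightarrow> \<bar>poly p s\<bar> \<le> B"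
    using poly_bounded_01[of p] by blast
  then show ?thesis using V
    by (intro integrable_const_bound[of _ B]) (auto elim: eventually_mono)
qed

text \<open>Exchanges the two arguments: the primitive at \<open>V\<close> times the polynomial at \<open>x\<close> becomes the polynomial at \<open>V\<close>
  times the integral from \<open>x\<close>, at the price of a boundary term. This holds for every
  distribution on \<open>[0, 1]\<close>, since only polynomials are involved.\<close>

lemma slegendre_series_by_parts:
  fixes V :: "'a \<Rightarrow> real"
  assumes V_meas: "V \<in> borel_measurable M" and V: "AE \<omega> in M. V \<omega> \<in> {0..1}" and x: "x \<in> {0..1}"
  defines "b \<equiv> \<lambda>k. expectation (\<lambda>\<omega>. poly (slegendre k) (V \<omega>))"
  shows "(\<Sum>k\<le>N. (2 * real k + 1) * expectation (\<lambda>\<omega>. poly (slegendre_prim k) (V \<omega>)) * poly (slegendre k) x) =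
         (\<Sum>k\<le>N. (2 * real k + 1) * b k * integral_to_1 x (slegendre k))
         + (b (Suc N) * poly (slegendre N) x + b N * poly (slegendre (Suc N)) x) / 2"
proof (induction N)
  case 0
  have "b 1 = expectation (\<lambda>\<omega>. 2 * V \<omega> - 1)"
    unfolding b_def by (simp add: mult.commute)
  also have "\<dots> = 2 * expectation V - 1"
    using integrable_poly[OF V_meas V, of "[:0, 1:]"] by (simp add: prob_space)
  finally show ?case
    using x by (simp add: b_def slegendre_prim_0 prob_space integral_to_1_1 field_simps)
next
  case (Suc N)
  have int: "integrable M (\<lambda>\<omega>. poly p (V \<omega>))" for p
    by (rule integrable_poly[OF V_meas V])
  have "2 * (2 * real N + 3) * expectation (\<lambda>\<omega>. poly (slegendre_prim (Suc N)) (V \<omega>))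
      = expectation (\<lambda>\<omega>. 2 * (2 * real N + 3) * poly (slegendre_prim (Suc N)) (V \<omega>))"
    by simp
  also have "\<dots> = b (Suc (Suc N)) - b N"
    unfolding slegendre_prim_Suc b_def using int by simp
  finally have 1: "2 * (2 * real N + 3) * expectation (\<lambda>\<omega>. poly (slegendre_prim (Suc N)) (V \<omega>)) = b (Suc (Suc N)) - b N" .
  have 2: "2 * (2 * real N + 3) * integral_to_1 x (slegendre (Suc N)) = poly (slegendre N) x - poly (slegendre (Suc (Suc N))) x"
    using x by (intro integral_to_1_slegendre_Suc) simp
  have "2 * (2 * real N + 3) * expectation (\<lambda>\<omega>. poly (slegendre_prim (Suc N)) (V \<omega>)) * poly (slegendre (Suc N)) x
     = 2 * (2 * real N + 3) * integral_to_1 x (slegendre (Suc N)) * b (Suc N)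
       + (b (Suc (Suc N)) * poly (slegendre (Suc N)) x + b (Suc N) * poly (slegendre (Suc (Suc N))) x)
       - (b (Suc N) * poly (slegendre N) x + b N * poly (slegendre (Suc N)) x)"
    unfolding 1 2 by (simp add: algebra_simps)
  with Suc.IH show ?case
    by (simp add: field_simps)
qed

end

lemma tendsto_0_if_weighted_bound:
  fixes a E :: "nat \<Rightarrow> real"
  assumes bound: "\<And>t N. 0 < t \<Longrightarrow> 2 * \<bar>a N\<bar> \<le> t * A + E N / t" and E: "E \<longlonglongrightarrow> 0" and A: "0 \<le> A"
  shows "a \<longlonglongrightarrow> 0"
proof (rule LIMSEQ_I)
  fix r :: real assume r: "0 < r"
  define t where "t = r / (A + 1)"
  have t: "0 < t" "t * A \<le> r" using r A by (auto simp: t_def field_simps)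
  have "0 < r * t" using r t by simp
  with LIMSEQ_D[OF E] obtain N0 where N0: "\<And>N. N0 \<le> N \<Longrightarrow> \<bar>E N\<bar> < r * t" by (metis diff_zero real_norm_def)
  have "norm (a N - 0) < r" if "N0 \<le> N" for N
  proof -
    have "E N / t < r" using N0[OF that] t(1) by (simp add: field_simps)
    with bound[OF t(1), of N] t(2) show ?thesis by simp
  qed
  then show "\<exists>no. \<forall>n\<ge>no. norm (a n - 0) < r" by blast
qed

context prob_space
begin

text \<open>The \<open>N\<close>-th partial sum is the tail probability minus the error \<open>r N\<close> of replacing the step by
  \<open>step_proj x N\<close> under the expectation, plus the boundary term of the summation by parts; both
  corrections tend to 0.\<close>

lemma slegendre_series_tail:
  assumes D: "distributed M lborel V (\<lambda>s. ennreal (f s))"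
    and f: "\<And>s. 0 \<le> f s" "integrable lborel (\<lambda>s. (f s)\<^sup>2)"
    and V: "AE \<omega> in M. V \<omega> \<in> {0..1}"
    and x: "x \<in> {0..1}"
  shows "(\<lambda>k. (2 * real k + 1) * expectation (\<lambda>\<omega>. poly (slegendre_prim k) (V \<omega>)) * poly (slegendre k) x)
           sums prob {\<omega> \<in> space M. x < V \<omega>}"
proof -
  define A where "A = (LINT s|lborel. (f s)\<^sup>2)"
  have A: "0 \<le> A" by (simp add: A_def)
  define b where "b k = expectation (\<lambda>\<omega>. poly (slegendre k) (V \<omega>))" for k
  have V_meas [measurable]: "V \<in> borel_measurable M"
    using distributed_measurable[OF D] by simp
  have int: "integrable M (\<lambda>\<omega>. poly p (V \<omega>))" for p
    by (rule integrable_poly[OF V_meas V])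
  have b0: "b \<longlonglongrightarrow> 0"
  proof (rule tendsto_0_if_weighted_bound[OF _ _ A])
    show "(\<lambda>k. integral_to_1 0 (slegendre k * slegendre k)) \<longlonglongrightarrow> 0"
    proof -
      have "integral_to_1 0 (slegendre k * slegendre k) = inverse (2 * real k + 1)" for k
        using slegendre_norm[of k] by (simp add: field_simps)
      moreover have "(\<lambda>k. inverse (2 * real k + 1)) \<longlonglongrightarrow> 0" by real_asymp
      ultimately show ?thesis by simp
    qed
    fix t :: real and k assume "0 < t"
    show "2 * \<bar>b k\<bar> \<le> t * A + integral_to_1 0 (slegendre k * slegendre k) / t"
      unfolding A_def b_def
    proof (rule expectation_L2_bound[OF D f V _ _ _ \<open>0 < t\<close>])
      show "\<bar>poly (slegendre k) s\<bar> \<le> 1" if "s \<in> {0..1}" for s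
        by (rule abs_poly_slegendre_le_1[OF that])
      show "((\<lambda>s. (poly (slegendre k) s)\<^sup>2) has_integral integral_to_1 0 (slegendre k * slegendre k)) {0..1}"
      proof -
        have "poly (slegendre k * slegendre k) = (\<lambda>s. (poly (slegendre k) s)\<^sup>2)"
          by (auto simp: power2_eq_square)
        then show ?thesis
          using integrable_integral[OF poly_integrable[of "slegendre k * slegendre k" 0]]
          by (simp add: integral_to_1_def)
      qed
    qed measurable
  qed
  define r where "r N = prob {\<omega> \<in> space M. x < V \<omega>} - (\<Sum>k\<le>N. (2 * real k + 1) * b k * integral_to_1 x (slegendre k))" for N
  have r0: "r \<longlonglongrightarrow> 0"
  proof (rule tendsto_0_if_weighted_bound[OF _ step_proj_tendsto[OF x] A])
    fix t :: real and N assume "0 < t"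
    have "expectation (\<lambda>\<omega>. poly (step_proj x N) (V \<omega>)) = (\<Sum>k\<le>N. (2 * real k + 1) * b k * integral_to_1 x (slegendre k))"
      unfolding step_proj_def poly_sum poly_smult
      by (subst Bochner_Integration.integral_sum) (auto simp: int b_def mult_ac)
    moreover have "expectation (\<lambda>\<omega>. indicator {x<..} (V \<omega>)) = prob {\<omega> \<in> space M. x < V \<omega>}"
    proof -
      have "expectation (\<lambda>\<omega>. indicator {x<..} (V \<omega>)) = expectation (indicat_real {\<omega> \<in> space M. x < V \<omega>})"
        by (intro Bochner_Integration.integral_cong) (auto split: split_indicator)
      then show ?thesis by simp
    qed
    moreover have "integrable M (\<lambda>\<omega>. indicator {x<..} (V \<omega>) :: real)"
      by (intro integrable_const_bound[of _ 1]) (auto split: split_indicator)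
    ultimately have r: "r N = expectation (\<lambda>\<omega>. indicator {x<..} (V \<omega>) - poly (step_proj x N) (V \<omega>))"
      by (simp add: r_def int)
    obtain B where B: "\<And>s. s \<in> {0..1} \<Longrightarrow> \<bar>poly (step_proj x N) s\<bar> \<le> B"
      using poly_bounded_01[of "step_proj x N"] by blast
    show "2 * \<bar>r N\<bar> \<le> t * A + step_err x (step_proj x N) / t"
      unfolding A_def r
    proof (rule expectation_L2_bound[OF D f V _ _ step_err_has_integral[OF x] \<open>0 < t\<close>])
      show "\<bar>indicator {x<..} s - poly (step_proj x N) s\<bar> \<le> 1 + B" if "s \<in> {0..1}" for s
        using B[OF that] by (auto split: split_indicator)
    qed measurable
  qed
  \<comment> \<open>The indices of the two factors are shifted against each other; only that of \<open>b\<close> matters.\<close>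
  have bP: "(\<lambda>N. b (i N) * poly (slegendre (j N)) x) \<longlonglongrightarrow> 0" if i: "filterlim i at_top sequentially" for i j
  proof (rule Lim_null_comparison)
    show "(\<lambda>N. \<bar>b (i N)\<bar>) \<longlonglongrightarrow> 0"
      using filterlim_compose[OF b0 i] by (simp add: tendsto_rabs_zero)
    show "\<forall>\<^sub>F N in sequentially. norm (b (i N) * poly (slegendre (j N)) x) \<le> \<bar>b (i N)\<bar>"
      using abs_poly_slegendre_le_1[OF x] by (auto simp: abs_mult intro!: always_eventually mult_left_le)
  qed
  have "(\<lambda>N. (prob {\<omega> \<in> space M. x < V \<omega>} - r N)
        + (b (Suc N) * poly (slegendre N) x + b N * poly (slegendre (Suc N)) x) / 2)
      \<longlonglongrightarrow> (prob {\<omega> \<in> space M. x < V \<omega>} - 0) + (0 + 0) / 2"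
    by (intro tendsto_intros r0 bP filterlim_Suc filterlim_ident) auto
  then show ?thesis
    unfolding sums_def_le slegendre_series_by_parts[OF V_meas V x]
    by (simp add: r_def b_def)
qed

end

section \<open>Square integrable densities under a change of variable\<close>

context prob_space
begin

text \<open>If \<open>Y\<close> has the density \<open>g\<close> and \<open>S\<close> parametrizes the values of \<open>Y\<close> by those of \<open>Z\<close>, then
  \<open>Z\<close> has the density \<open>g (S v) * S' v\<close>. Its square carries one factor \<open>S' v\<close> more than the substitution rule consumes, hence the bound on \<open>S'\<close>.\<close>

lemma square_integrable_density_transform:
  fixes Y Z :: "'a \<Rightarrow> real" and S S' T :: "real \<Rightarrow> real"
  assumes Y: "has_square_integrable_density M Y"
    and Z [measurable]: "Z \<in> borel_measurable M"
    and YZ: "AE \<omega> in M. Y \<omega> \<in> {S c..S d} \<and> Z \<omega> = T (Y \<omega>)"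
    and T [measurable]: "T \<in> borel_measurable borel" and TS: "\<And>v. v \<in> {c..d} \<Longrightarrow> T (S v) = v"
    and S [measurable]: "S \<in> borel_measurable borel" and S' [measurable]: "S' \<in> borel_measurable borel"
    and cd: "c \<le> d"
    and deriv: "\<And>v. v \<in> {c..d} \<Longrightarrow> (S has_real_derivative S' v) (at v)"
    and cont: "continuous_on {c..d} S'"
    and bnd: "\<And>v. v \<in> {c..d} \<Longrightarrow> 0 \<le> S' v \<and> S' v \<le> C"
  shows "has_square_integrable_density M Z"
proof -
  from Y obtain g where g: "\<And>u. 0 \<le> g u" and D: "distributed M lborel Y (\<lambda>u. ennreal (g u))"
    and g2: "integrable lborel (\<lambda>u. (g u)\<^sup>2)"
    by (auto simp: has_square_integrable_density_def)
  have [measurable]: "g \<in> borel_measurable borel"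
    using distributed_real_measurable[OF _ D] g by simp
  have [measurable]: "Y \<in> borel_measurable M"
    using distributed_measurable[OF D] by simp
  have subst: "(\<integral>\<^sup>+ u. ennreal (h u) * indicator {S c..S d} u \<partial>lborel)
      = (\<integral>\<^sup>+ v. ennreal (h (S v) * S' v) * indicator {c..d} v \<partial>lborel)"
    if [measurable]: "h \<in> borel_measurable borel" for h
    using nn_integral_substitution[of S c d h S'] deriv cont bnd cd
    by (simp add: set_borel_measurable_def nn_integral_set_ennreal)
  define f where "f v = indicator {c..d} v * (g (S v) * S' v)" for v
  have [measurable]: "f \<in> borel_measurable borel" unfolding f_def by measurable
  have f0: "0 \<le> f v" for v using g bnd by (auto simp: f_def split: split_indicator)
  have "distributed M lborel Z (\<lambda>v. ennreal (f v))"
    unfolding distributed_def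
  proof (intro conjI)
    show "distr M lborel Z = density lborel (\<lambda>v. ennreal (f v))"
    proof (rule measure_eqI)
      fix A assume "A \<in> sets (distr M lborel Z)"
      then have A [measurable]: "A \<in> sets borel" by simp
      have "emeasure (distr M lborel Z) A = (\<integral>\<^sup>+ \<omega>. indicator A (Z \<omega>) \<partial>M)"
        using nn_integral_distr[of Z M lborel "indicator A"] by simp
      also have "\<dots> = (\<integral>\<^sup>+ \<omega>. indicator A (T (Y \<omega>)) * indicator {S c..S d} (Y \<omega>) \<partial>M)"
      proof (rule nn_integral_cong_AE)
        show "AE \<omega> in M. indicator A (Z \<omega>) = indicator A (T (Y \<omega>)) * (indicator {S c..S d} (Y \<omega>) :: ennreal)"
          using YZ by eventually_elim simp
      qed
      also have "\<dots> = (\<integral>\<^sup>+ u. ennreal (g u) * (indicator A (T u) * indicator {S c..S d} u) \<partial>lborel)"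
        by (rule distributed_nn_integral[OF D, symmetric]) measurable
      also have "\<dots> = (\<integral>\<^sup>+ u. ennreal (g u * indicator A (T u)) * indicator {S c..S d} u \<partial>lborel)"
        by (intro nn_integral_cong) (auto split: split_indicator)
      also have "\<dots> = (\<integral>\<^sup>+ v. ennreal (g (S v) * indicator A (T (S v)) * S' v) * indicator {c..d} v \<partial>lborel)"
        by (rule subst) measurable
      also have "\<dots> = (\<integral>\<^sup>+ v. ennreal (f v) * indicator A v \<partial>lborel)"
        by (intro nn_integral_cong) (auto simp: f_def TS split: split_indicator)
      finally show "emeasure (distr M lborel Z) A = emeasure (density lborel (\<lambda>v. ennreal (f v))) A"
        by (simp add: emeasure_density)
    qed simp
  qed simp_all
  moreover have "integrable lborel (\<lambda>v. (f v)\<^sup>2)"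
  proof (rule integrableI_nonneg)
    have "(\<integral>\<^sup>+ v. ennreal ((f v)\<^sup>2) \<partial>lborel)
        \<le> (\<integral>\<^sup>+ v. ennreal (C * (g (S v))\<^sup>2 * S' v) * indicator {c..d} v \<partial>lborel)"
    proof (intro nn_integral_mono)
      fix v
      show "ennreal ((f v)\<^sup>2) \<le> ennreal (C * (g (S v))\<^sup>2 * S' v) * indicator {c..d} v"
      proof (cases "v \<in> {c..d}")
        case True
        then have "S' v * ((g (S v))\<^sup>2 * S' v) \<le> C * ((g (S v))\<^sup>2 * S' v)"
          using bnd by (intro mult_right_mono) auto
        with True show ?thesis
          by (auto simp: f_def power2_eq_square mult_ac intro!: ennreal_leI)
      qed (simp add: f_def)
    qed
    also have "\<dots> = (\<integral>\<^sup>+ u. ennreal (C * (g u)\<^sup>2) * indicator {S c..S d} u \<partial>lborel)"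
      by (rule subst[symmetric]) measurable
    also have "\<dots> \<le> (\<integral>\<^sup>+ u. ennreal (C * (g u)\<^sup>2) \<partial>lborel)"
      by (intro nn_integral_mono) (auto split: split_indicator)
    also have "\<dots> < \<infinity>"
    proof -
      have "integrable lborel (\<lambda>u. C * (g u)\<^sup>2)" using g2 by simp
      moreover have "0 \<le> C" using bnd[of c] cd by auto
      ultimately show ?thesis by (simp add: nn_integral_eq_integral)
    qed
    finally show "(\<integral>\<^sup>+ v. ennreal ((f v)\<^sup>2) \<partial>lborel) < \<infinity>" .
  qed (auto intro!: AE_I2)
  ultimately show ?thesis
    using f0 unfolding has_square_integrable_density_def by blast
qed

text \<open>Both directions are changes of variable; the lower bound \<open>a\<close> keeps the derivative of
  the square root bounded.\<close>

lemma square_integrable_density_square_iff: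
  assumes [measurable]: "Y \<in> borel_measurable M" and a: "0 < a" "a \<le> 1" and Y: "AE \<omega> in M. Y \<omega> \<in> {a..1}"
  shows "has_square_integrable_density M Y \<longleftrightarrow> has_square_integrable_density M (\<lambda>\<omega>. (Y \<omega>)\<^sup>2)"
proof
  assume "has_square_integrable_density M Y"
  then show "has_square_integrable_density M (\<lambda>\<omega>. (Y \<omega>)\<^sup>2)"
  proof (rule square_integrable_density_transform[where S = sqrt and S' = "\<lambda>v. inverse (2 * sqrt v)"
        and T = "\<lambda>u. u\<^sup>2" and c = "a\<^sup>2" and d = 1 and C = "inverse (2 * a)"])
    show "AE \<omega> in M. Y \<omega> \<in> {sqrt (a\<^sup>2)..sqrt 1} \<and> (Y \<omega>)\<^sup>2 = (Y \<omega>)\<^sup>2"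
      using Y a by simp
    fix v assume v: "v \<in> {a\<^sup>2..1}"
    have "0 < a\<^sup>2" using a by simp
    with v have v0: "0 < v" unfolding atLeastAtMost_iff by (blast intro: less_le_trans)
    from v0 show "(sqrt v)\<^sup>2 = v" by simp
    show "(sqrt has_real_derivative inverse (2 * sqrt v)) (at v)"
      using v0 by (auto intro!: derivative_eq_intros simp: field_simps)
    have "a \<le> sqrt v" using v a by (intro real_le_rsqrt) auto
    then show "0 \<le> inverse (2 * sqrt v) \<and> inverse (2 * sqrt v) \<le> inverse (2 * a)"
      using a v0 by (auto intro!: le_imp_inverse_le)
  next
    have "sqrt v \<noteq> 0" if "v \<in> {a\<^sup>2..1}" for v
    proof -
      have "0 < a\<^sup>2" using a by simp
      with that have "0 < v" unfolding atLeastAtMost_iff by (blast intro: less_le_trans)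
      then show ?thesis by simp
    qed
    then show "continuous_on {a\<^sup>2..1} (\<lambda>v. inverse (2 * sqrt v))"
      by (intro continuous_intros) auto
    show "a\<^sup>2 \<le> 1" using a by (simp add: power_le_one)
  qed measurable
next
  assume "has_square_integrable_density M (\<lambda>\<omega>. (Y \<omega>)\<^sup>2)"
  then show "has_square_integrable_density M Y"
  proof (rule square_integrable_density_transform[where S = "\<lambda>v. v\<^sup>2" and S' = "\<lambda>v. 2 * v"
        and T = sqrt and c = a and d = 1 and C = 2])
    show "AE \<omega> in M. (Y \<omega>)\<^sup>2 \<in> {a\<^sup>2..1\<^sup>2} \<and> Y \<omega> = sqrt ((Y \<omega>)\<^sup>2)"
      using Y by eventually_elim (use a in \<open>auto simp: power_mono power_le_one\<close>)
    show "a \<le> 1" by (rule a)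
    fix v assume v: "v \<in> {a..1}"
    then show "sqrt (v\<^sup>2) = v" using a by simp
    show "((\<lambda>v. v\<^sup>2) has_real_derivative 2 * v) (at v)"
      by (auto intro!: derivative_eq_intros)
    show "0 \<le> 2 * v \<and> 2 * v \<le> 2" using v a by auto
  next
    show "continuous_on {a..1} (\<lambda>v. 2 * v :: real)" by (intro continuous_intros)
  qed measurable
qed

end

section \<open>The self-normalized sum\<close>

text \<open>The lower bound is the Cauchy--Schwarz inequality against the constant 1; for the upper bound each
  summand is at most the whole sum.\<close>

lemma square_self_norm_ratio_bounds:
  assumes n: "0 < n" and X: "\<And>i. i \<in> {1..n} \<Longrightarrow> 0 < X i \<omega>"
  shows "0 \<le> self_norm_ratio n X \<omega>" "(self_norm_ratio n X \<omega>)\<^sup>2 \<in> {1 / real n..1}"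
proof -
  define Q where "Q = (\<Sum>i = 1..n. (X i \<omega>)\<^sup>2)"
  define S where "S = (\<Sum>i = 1..n. X i \<omega>)"
  have S: "0 < S" unfolding S_def using n X by (intro sum_pos) auto
  have Q: "0 \<le> Q" unfolding Q_def by (intro sum_nonneg) simp
  show "0 \<le> self_norm_ratio n X \<omega>"
    using S Q by (simp only: self_norm_ratio_def flip: Q_def S_def) simp
  have sq: "(self_norm_ratio n X \<omega>)\<^sup>2 = Q / S\<^sup>2"
    using Q by (simp only: self_norm_ratio_def flip: Q_def S_def) (simp add: power_divide)
  have "Q \<le> (\<Sum>i = 1..n. X i \<omega> * S)"
    unfolding Q_def power2_eq_square
  proof (intro sum_mono mult_left_mono)
    fix i assume i: "i \<in> {1..n}"
    show "X i \<omega> \<le> S" unfolding S_def using i X by (intro member_le_sum) (auto intro: less_imp_le)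
    show "0 \<le> X i \<omega>" using X[OF i] by simp
  qed
  then have "Q \<le> S\<^sup>2" by (simp add: S_def power2_eq_square flip: sum_distrib_right)
  moreover have "S\<^sup>2 \<le> real n * Q"
    using Cauchy_Schwarz_ineq_sum[of "\<lambda>i. X i \<omega>" "\<lambda>_. 1" "{1..n}"] by (simp add: S_def Q_def mult.commute)
  ultimately show "(self_norm_ratio n X \<omega>)\<^sup>2 \<in> {1 / real n..1}"
    unfolding sq using S n by (simp add: field_simps)
qed

theorem mainTheorem4:
  fixes M :: "'a measure" and X :: "nat \<Rightarrow> 'a \<Rightarrow> real"
    and \<alpha> :: real and n :: nat
  assumes "prob_space M"
    and "0 < \<alpha>" and "2 \<le> n"
    and "prob_space.indep_vars M (\<lambda>_. borel) X {1..n}"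
    and "\<And>i. i \<in> {1..n} \<Longrightarrow> distributed M lborel (X i) (\<lambda>x. ennreal (gamma_density \<alpha> x))"
  defines "U \<equiv> self_norm_ratio n X"
  defines "F \<equiv> cdf (distr M borel (\<lambda>\<omega>. (U \<omega>)\<^sup>2))"
  defines "\<mu> \<equiv> (\<lambda>m::nat. integral\<^sup>L M (\<lambda>\<omega>. U \<omega> ^ m))"
  shows "(has_square_integrable_density M U \<longleftrightarrow>
            has_square_integrable_density M (\<lambda>\<omega>. (U \<omega>)\<^sup>2)) \<and>
         (has_square_integrable_density M U \<longrightarrow>
            (\<forall>x \<in> {1 / real n..1}.
               (\<lambda>k. (-1) ^ k * (2 * real k + 1) *
                  (\<Sum>j = 0..k. (-1) ^ j *
                     (pochhammer (real k - real j + 1) (2 * j) / (fact j * fact j)) *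
                     (\<mu> (2 * (j + 1)) / real (j + 1))) *
                  shifted_legendre k x)
               sums (1 - F x)))"
proof -
  interpret prob_space M by fact
  have n: "0 < n" "1 \<le> real n" using \<open>2 \<le> n\<close> by auto
  have X_meas: "X i \<in> borel_measurable M" if "i \<in> {1..n}" for i
    using distributed_measurable[OF assms(5)[OF that]] by simp
  have [measurable]: "U \<in> borel_measurable M"
    unfolding U_def self_norm_ratio_def using X_meas by measurable
  have X_pos: "AE \<omega> in M. 0 < X i \<omega>" if "i \<in> {1..n}" for i
    by (subst distributed_AE2[OF assms(5)[OF that]]) (auto simp: gamma_density_def)
  have "AE \<omega> in M. \<forall>i\<in>{1..n}. 0 < X i \<omega>"
    using X_pos by (intro AE_finite_allI) auto
  then have U: "AE \<omega> in M. 0 \<le> U \<omega> \<and> (U \<omega>)\<^sup>2 \<in> {1 / real n..1}"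
  proof eventually_elim
    case (elim \<omega>)
    then show ?case
      unfolding U_def using square_self_norm_ratio_bounds[OF n(1), of X \<omega>] by blast
  qed
  have U_bounds: "AE \<omega> in M. U \<omega> \<in> {sqrt (1 / real n)..1}"
    using U by eventually_elim (auto simp: real_le_lsqrt abs_square_le_1)
  then have iff: "has_square_integrable_density M U \<longleftrightarrow> has_square_integrable_density M (\<lambda>\<omega>. (U \<omega>)\<^sup>2)"
    using n by (intro square_integrable_density_square_iff[OF _ _ _ U_bounds]) auto
  moreover have "(\<lambda>k. (-1) ^ k * (2 * real k + 1) *
                  (\<Sum>j = 0..k. (-1) ^ j *
                     (pochhammer (real k - real j + 1) (2 * j) / (fact j * fact j)) *
                     (\<mu> (2 * (j + 1)) / real (j + 1))) *
                  shifted_legendre k x) sums (1 - F x)"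
    if dens: "has_square_integrable_density M U" and x: "x \<in> {1 / real n..1}" for x
  proof -
    define V where "V \<omega> = (U \<omega>)\<^sup>2" for \<omega>
    have V_meas [measurable]: "V \<in> borel_measurable M" unfolding V_def by measurable
    have "0 \<le> 1 / real n" by simp
    then have x01: "x \<in> {0..1}" using x unfolding atLeastAtMost_iff by linarith
    have V01: "AE \<omega> in M. V \<omega> \<in> {0..1}"
      using U by eventually_elim (auto simp: V_def)
    from dens iff have "has_square_integrable_density M V" by (simp add: V_def[abs_def])
    then obtain f where f: "\<And>s. 0 \<le> f s" "integrable lborel (\<lambda>s. (f s)\<^sup>2)"
      and D: "distributed M lborel V (\<lambda>s. ennreal (f s))"
      by (auto simp: has_square_integrable_density_def)
    have "F x = prob {\<omega> \<in> space M. V \<omega> \<le> x}"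
      unfolding F_def cdf_def V_def[symmetric]
      by (subst measure_distr) (auto intro!: arg_cong[where f = prob])
    then have tail: "1 - F x = prob {\<omega> \<in> space M. x < V \<omega>}"
      using prob_neg[of "\<lambda>\<omega>. V \<omega> \<le> x"] by (simp add: not_le)
    have "(-1) ^ k * (\<Sum>j = 0..k. (-1) ^ j *
             (pochhammer (real k - real j + 1) (2 * j) / (fact j * fact j)) * (\<mu> (2 * (j + 1)) / real (j + 1)))
          = expectation (\<lambda>\<omega>. poly (slegendre_prim k) (V \<omega>))" for k
    proof -
      have int: "integrable M (\<lambda>\<omega>. V \<omega> ^ m)" for m
        using integrable_poly[OF V_meas V01, of "monom 1 m"] by (simp add: poly_monom)
      have "expectation (\<lambda>\<omega>. poly (slegendre_prim k) (V \<omega>))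
         = (\<Sum>j\<le>k. coeff (slegendre k) j / real (j + 1) * expectation (\<lambda>\<omega>. V \<omega> ^ (j + 1)))"
        unfolding slegendre_prim_def poly_sum poly_monom
        by (subst Bochner_Integration.integral_sum) (use int[of "_ + 1"] in auto)
      also have "\<dots> = (\<Sum>j\<le>k. (-1) ^ k * ((-1) ^ j *
             (pochhammer (real k - real j + 1) (2 * j) / (fact j * fact j)) * (\<mu> (2 * (j + 1)) / real (j + 1))))"
      proof (intro sum.cong refl)
        fix j
        have "expectation (\<lambda>\<omega>. V \<omega> ^ (j + 1)) = \<mu> (2 * (j + 1))"
          unfolding \<mu>_def V_def power_mult ..
        then show "coeff (slegendre k) j / real (j + 1) * expectation (\<lambda>\<omega>. V \<omega> ^ (j + 1)) = (-1) ^ k * ((-1) ^ j *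
             (pochhammer (real k - real j + 1) (2 * j) / (fact j * fact j)) * (\<mu> (2 * (j + 1)) / real (j + 1)))"
          by (simp only: coeff_slegendre) (simp add: power_add power2_eq_square)
      qed
      finally show ?thesis by (simp add: sum_distrib_left atMost_atLeast0)
    qed
    from this[symmetric] have eq: "(-1) ^ k * (2 * real k + 1) *
                  (\<Sum>j = 0..k. (-1) ^ j *
                     (pochhammer (real k - real j + 1) (2 * j) / (fact j * fact j)) *
                     (\<mu> (2 * (j + 1)) / real (j + 1))) * shifted_legendre k x
        = (2 * real k + 1) * expectation (\<lambda>\<omega>. poly (slegendre_prim k) (V \<omega>)) * poly (slegendre k) x" for k
      by (simp add: shifted_legendre_eq mult_ac)
    show ?thesis
      unfolding eq tail by (rule slegendre_series_tail[OF D f V01 x01])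
  qed
  ultimately show ?thesis by blast
qed

end
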